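(* Let $m>1$ be an integer and let $\mathcal{D}=(P,\mathcal{B})$ be a Hadamard $(4m-1,2m-1,m-1)$-design. If $\mathcal{D}$ is $(2m-1)$-pyramidal under the action of a group $G$ of automorphisms of $\mathcal{D}$, then there is an integer $k>1$ such that: (1) $G$ is an elementary abelian $2$-group of order $2m=2^{k}$; and (2) the complement $\mathcal{D}^c$ is the sum of a symmetric $(2^{k}-1,2^{k-1},2^{k-2})$-design and (a design isomorphic to) the design of points and hyperplane complements of $\mathrm{PG}(k-1,2)$.
   Context: A $(v,k,\lambda)$-design is a pair $\mathcal{D}=(P,\mathcal{B})$ where $P$ is a set of $v$ points and $\mathcal{B}$ is a collection of $k$-subsets of $P$, called blocks, such that every pair of distinct points of $P$ occurs in exactly $\lambda$ blocks. It is symmetric if $|\mathcal{B}|=v$. A Hadamard design is a symmetric design with parameters $(4m-1,2m-1,m-1)$. The complement of $\mathcal{D}$ is $\mathcal{D}^c=(P,\mathcal{B}^c)$ with $\mathcal{B}^c=\{P\setminus B\mid B\in\mathcal{B}\}$; the complement of a Hadamard $(4m-1,2m-1,m-1)$-design is a symmetric $(4m-1,2m,m)$-design. An automorphism of $\mathcal{D}$ is a permutation of $P$ mapping $\mathcal{B}$ onto itself. Given a group $G$ of automorphisms of $\mathcal{D}$, the design $\mathcal{D}$ is $f$-pyramidal under the action of $G$ if $G$ fixes exactly $f$ points and acts sharply transitively (regularly) on the remaining $v-f$ points. Sum of designs: let $P$ be a set of size $2^{r}-1$ and let $O\subset P$ with $|O|=2^{r-1}$; put $O^c=P\setminus O$.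 Choose a subset $Z\subset O$ with $|Z|=2^{r-1}-1$, two symmetric $(2^{r-1}-1,2^{r-2},2^{r-3})$-designs $\mathcal{D}_{O^c}=(O^c,\mathcal{B}_O)$ and $\mathcal{D}_Z=(Z,\mathcal{B}_Z)$, and a bijection $\delta:\mathcal{B}_O\to\mathcal{B}_Z$. Let $\mathcal{B}'$ be the set consisting of $O$ and of all sets of the form $X\cup\delta(X)$ and $X\cup(O\setminus\delta(X))$ for $X\in\mathcal{B}_O$. Then $(P,\mathcal{B}')$ is a symmetric $(2^{r}-1,2^{r-1},2^{r-2})$-design, and any design obtained in this way (for some choice of $O$, $Z$, $\delta$) is called the sum of $\mathcal{D}_{O^c}$ and $\mathcal{D}_Z$ (in this order: the first summand is the design on $O^c$, the second is the design on $Z$). In the claim this is applied with $r=k+1$. The design of points and hyperplane complements of $\mathrm{PG}(k-1,2)$ has as points the points of the projective space $\mathrm{PG}(k-1,2)$ (equivalently, the nonzero vectors of $\mathbb{F}_2^k$) and as blocks the complements, in the point set, of the hyperplanes of $\mathrm{PG}(k-1,2)$; it is a symmetric $(2^k-1,2^{k-1},2^{k-2})$-design. *)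

theory Defs
  imports
    Complex_Main
    "HOL-Algebra.Bij"
    "HOL-Algebra.Coset"
    "HOL-Computational_Algebra.Primes"
    "HOL-Library.Function_Algebras"
    "HOL-Library.Z2"
begin

section \<open>Designs\<close>

text \<open>
  Blocks form a set of subsets. This is no restriction for the symmetric designs with
  \<open>\<lambda> < k\<close> considered here: two distinct blocks of such a design, repeated ones included,
  meet in exactly \<open>\<lambda>\<close> points, so there are no repeated blocks.
\<close>

definition design :: "'a set \<Rightarrow> 'a set set \<Rightarrow> nat \<Rightarrow> nat \<Rightarrow> nat \<Rightarrow> bool" where
  "design P \<B> v k l \<longleftrightarrow>
     finite P \<and> card P = v \<and>
     (\<forall>B\<in>\<B>. B \<subseteq> P \<and> card B = k) \<and>
     (\<forall>x\<in>P. \<forall>y\<in>P. x \<noteq> y \<longrightarrow> card {B \<in> \<B>. x \<in> B \<and> y \<in> B} = l)"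

definition symmetric_design :: "'a set \<Rightarrow> 'a set set \<Rightarrow> nat \<Rightarrow> nat \<Rightarrow> nat \<Rightarrow> bool" where
  "symmetric_design P \<B> v k l \<longleftrightarrow> design P \<B> v k l \<and> card \<B> = v"

text \<open>The subtractions are on natural numbers; they are exact for \<open>m \<ge> 1\<close>.\<close>

definition hadamard_design :: "'a set \<Rightarrow> 'a set set \<Rightarrow> nat \<Rightarrow> bool" where
  "hadamard_design P \<B> m \<longleftrightarrow> symmetric_design P \<B> (4 * m - 1) (2 * m - 1) (m - 1)"

definition complement_blocks :: "'a set \<Rightarrow> 'a set set \<Rightarrow> 'a set set" where
  "complement_blocks P \<B> = {P - B | B. B \<in> \<B>}"

definition design_isomorphic :: "'a set \<Rightarrow> 'a set set \<Rightarrow> 'b set \<Rightarrow> 'b set set \<Rightarrow> bool" where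
  "design_isomorphic P \<B> Q \<C> \<longleftrightarrow> (\<exists>f. bij_betw f P Q \<and> (\<lambda>B. f ` B) ` \<B> = \<C>)"

section \<open>Groups of automorphisms\<close>

text \<open>
  As in \<^const>\<open>BijGroup\<close>, a permutation of \<open>P\<close> is a function that is \<^term>\<open>undefined\<close>
  outside \<open>P\<close>, and the product is composition.
\<close>

definition AutDesign :: "'a set \<Rightarrow> 'a set set \<Rightarrow> ('a \<Rightarrow> 'a) monoid" where
  "AutDesign P \<B> =
     (BijGroup P) \<lparr>carrier := {g \<in> Bij P. (\<lambda>B. g ` B) ` \<B> = \<B>}\<rparr>"

definition fixed_points :: "('a \<Rightarrow> 'a) set \<Rightarrow> 'a set \<Rightarrow> 'a set" where
  "fixed_points G P = {x \<in> P. \<forall>g\<in>G. g x = x}"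

definition sharply_transitive_on :: "('a \<Rightarrow> 'a) set \<Rightarrow> 'a set \<Rightarrow> bool" where
  "sharply_transitive_on G X \<longleftrightarrow> (\<forall>x\<in>X. \<forall>y\<in>X. \<exists>!g. g \<in> G \<and> g x = y)"

definition pyramidal_under :: "nat \<Rightarrow> 'a set \<Rightarrow> 'a set set \<Rightarrow> ('a \<Rightarrow> 'a) set \<Rightarrow> bool" where
  "pyramidal_under f P \<B> G \<longleftrightarrow>
     subgroup G (AutDesign P \<B>) \<and>
     card (fixed_points G P) = f \<and>
     sharply_transitive_on G (P - fixed_points G P)"

definition elementary_abelian :: "nat \<Rightarrow> ('g, 'c) monoid_scheme \<Rightarrow> bool" where
  "elementary_abelian p G \<longleftrightarrow>
     prime p \<and> comm_group G \<and> (\<forall>x\<in>carrier G. x [^]\<^bsub>G\<^esub> p = \<one>\<^bsub>G\<^esub>)"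

section \<open>Sums of designs\<close>

text \<open>
  \<open>sum_of_designs r P \<B>' P\<^sub>1 \<B>\<^sub>1 Z \<B>\<^sub>2\<close>: the design \<open>(P, \<B>')\<close> is a sum of
  \<open>(P\<^sub>1, \<B>\<^sub>1)\<close> and \<open>(Z, \<B>\<^sub>2)\<close>, in this order. The condition \<open>r \<ge> 3\<close> makes
  the parameter \<open>2 ^ (r - 3)\<close> of the summands meaningful.
\<close>

definition sum_of_designs ::
  "nat \<Rightarrow> 'a set \<Rightarrow> 'a set set \<Rightarrow> 'a set \<Rightarrow> 'a set set \<Rightarrow> 'a set \<Rightarrow> 'a set set \<Rightarrow> bool" where
  "sum_of_designs r P \<B>' P\<^sub>1 \<B>\<^sub>1 Z \<B>\<^sub>2 \<longleftrightarrow>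
     r \<ge> 3 \<and> card P = 2 ^ r - 1 \<and>
     (\<exists>O'. O' \<subset> P \<and> card O' = 2 ^ (r - 1) \<and> P\<^sub>1 = P - O' \<and>
        Z \<subset> O' \<and> card Z = 2 ^ (r - 1) - 1 \<and>
        symmetric_design P\<^sub>1 \<B>\<^sub>1 (2 ^ (r - 1) - 1) (2 ^ (r - 2)) (2 ^ (r - 3)) \<and>
        symmetric_design Z \<B>\<^sub>2 (2 ^ (r - 1) - 1) (2 ^ (r - 2)) (2 ^ (r - 3)) \<and>
        (\<exists>\<delta>. bij_betw \<delta> \<B>\<^sub>1 \<B>\<^sub>2 \<and>
           \<B>' = {O'} \<union> {X \<union> \<delta> X | X. X \<in> \<B>\<^sub>1} \<union> {X \<union> (O' - \<delta> X) | X. X \<in> \<B>\<^sub>1}))"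

section \<open>The design of points and hyperplane complements of a binary projective space\<close>

text \<open>
  The dimension has to be quantified over, so \<open>\<bbbF>\<^sub>2\<^sup>k\<close> is represented as the subspace of
  the sequences over the two-element field \<^typ>\<open>bit\<close> that vanish from index \<open>k\<close> on.
\<close>

definition bit_scale :: "bit \<Rightarrow> (nat \<Rightarrow> bit) \<Rightarrow> nat \<Rightarrow> bit" where
  "bit_scale c v = (\<lambda>i. c * v i)"

global_interpretation bitvec: vector_space bit_scale
  by unfold_locales (simp_all only: bit_scale_def fun_eq_iff plus_fun_def distrib_left distrib_right mult.assoc mult_1_left simp_thms)

definition bit_space :: "nat \<Rightarrow> (nat \<Rightarrow> bit) set" where
  "bit_space k = {v. \<forall>i\<ge>k. v i = 0}"

text \<open>
  Over the two-element field, a point of the projective space is the same as a nonzero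
  vector, and a hyperplane is the set of nonzero vectors of a subspace of dimension
  \<open>k - 1\<close>.
\<close>

definition PG_points :: "nat \<Rightarrow> (nat \<Rightarrow> bit) set" where
  "PG_points k = bit_space k - {0}"

definition PG_hyperplanes :: "nat \<Rightarrow> (nat \<Rightarrow> bit) set set" where
  "PG_hyperplanes k =
     {W - {0} | W. bitvec.subspace W \<and> W \<subseteq> bit_space k \<and> bitvec.dim W = k - 1}"

definition PG_hyperplane_complements :: "nat \<Rightarrow> (nat \<Rightarrow> bit) set set" where
  "PG_hyperplane_complements k = complement_blocks (PG_points k) (PG_hyperplanes k)"

end

theory Submission
  imports Defs
begin

text \<open>
  Let \<open>F\<close> be the set of the \<open>2 * m - 1\<close> fixed points of \<open>G\<close>, and \<open>M\<close> its complement, on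
  which \<open>G\<close> acts regularly, so that \<open>G\<close> has order \<open>2 * m\<close>. A non-identity element of \<open>G\<close> fixes
  exactly the points of \<open>F\<close>, and an automorphism of a symmetric design fixes as many blocks as
  points (\<open>fixed_blocks_eq_fixed_points\<close>). Counting the pairs of a block and an element that fixes
  it, once by elements and once by blocks, shows that the stabilizers of the blocks have total
  order \<open>4 * m * m\<close>. The only block that all of \<open>G\<close> can fix is \<open>F\<close>, and every other stabilizer has
  order at most \<open>m\<close>; since there are only \<open>4 * m - 1\<close> blocks, the total is reached only if \<open>F\<close> is
  a block (\<open>F_block\<close>) and all the other stabilizers have index exactly two (\<open>card_stab\<close>).

  Every block \<open>B \<noteq> F\<close> therefore cuts \<open>M\<close> into two halves, which each element of \<open>G\<close> either
  preserves or exchanges (\<open>mem_block_iff\<close>). Since the blocks separate points, an element is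
  determined by what it does to all of these partitions. So \<open>G\<close> embeds into a power of the group of
  order two: it is elementary abelian, of order \<open>2 * m = 2 ^ k\<close>. Moreover the two halves occur with
  the same trace on \<open>F\<close>: with \<open>B\<close>, also \<open>(F \<inter> B) \<union> (M - B)\<close> is a block (\<open>twist_block\<close>). Fix a
  point \<open>z\<close> of \<open>M\<close>. Exactly one block of each such pair contains \<open>z\<close>, and for these blocks the
  sets \<open>F - B\<close> form a symmetric design on \<open>F\<close> and the sets \<open>M - B\<close> one on \<open>M - {z}\<close>. The complement
  of the given design is the sum of the two (\<open>complement_sum\<close>).

  Finally, \<open>G\<close> is identified with \<open>M\<close> through its action on \<open>z\<close>, and with the binary vectors of
  length \<open>k\<close> through a group isomorphism. If \<open>B\<close> contains \<open>z\<close>, then \<open>B \<inter> M\<close> is the orbit of \<open>z\<close>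
  under a subgroup of index two, so it becomes a hyperplane and \<open>M - B\<close> a hyperplane complement.
  There are \<open>2 ^ k - 1\<close> blocks through \<open>z\<close> and no more than \<open>2 ^ k - 1\<close> hyperplanes
  (\<open>card_PG_hyperplane_complements\<close>), hence all hyperplanes arise (\<open>moved_design_isomorphic\<close>).
\<close>

section \<open>Symmetric designs and their automorphisms\<close>

lemma double_count:
  assumes "finite A" "finite B"
  shows "(\<Sum>x\<in>A. card {y\<in>B. R x y}) = (\<Sum>y\<in>B. card {x\<in>A. R x y})"
  using sum.swap_restrict[OF assms, of "\<lambda>_ _. 1::nat" R] by simp

text \<open>The form without subtraction lets both sides of a double count be compared directly.\<close>
lemma sum_two_values:
  fixes a b :: nat
  assumes "finite A"
  shows "(\<Sum>x\<in>A. if Q x then a else b) + b * card {x\<in>A. Q x} = a * card {x\<in>A. Q x} + b * card A"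
proof -
  have "(\<Sum>x\<in>A. (if Q x then a else b) + (if Q x then b else 0)) = (\<Sum>x\<in>A. (if Q x then a else 0) + b)"
    by (intro sum.cong) auto
  moreover have "(\<Sum>x\<in>A. if Q x then c else 0) = c * card {x\<in>A. Q x}" for c :: nat
    using assms by (simp flip: sum.inter_filter)
  ultimately show ?thesis by (simp add: sum.distrib)
qed

locale sym_design =
  fixes P :: "'a set" and \<B> :: "'a set set" and v k l :: nat
  assumes sym: "symmetric_design P \<B> v k l" and k_gt_1: "1 < k"
begin

lemma finite_points: "finite P" and card_points: "card P = v" and card_blocks: "card \<B> = v"
  and block_subset: "B \<in> \<B> \<Longrightarrow> B \<subseteq> P" and card_block: "B \<in> \<B> \<Longrightarrow> card B = k"
  and pair_count: "x \<in> P \<Longrightarrow> y \<in> P \<Longrightarrow> x \<noteq> y \<Longrightarrow> card {B\<in>\<B>. x \<in> B \<and> y \<in> B} = l"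
  using sym by (auto simp: symmetric_design_def design_def)

lemma finite_blocks: "finite \<B>"
  using finite_points block_subset by (meson finite_Pow_iff finite_subset PowI subsetI)

lemma finite_block: "B \<in> \<B> \<Longrightarrow> finite B"
  using block_subset finite_points finite_subset by blast

text \<open>
  Both sides count the pairs of a block through \<open>x\<close> and a second point on it.
\<close>
lemma replication_times:
  assumes "x \<in> P"
  shows "card {B\<in>\<B>. x \<in> B} * (k - 1) = l * (v - 1)"
proof -
  let ?Bx = "{B\<in>\<B>. x \<in> B}"
  have "(\<Sum>y\<in>P-{x}. card {B\<in>?Bx. y \<in> B}) = (\<Sum>B\<in>?Bx. card {y\<in>P-{x}. y \<in> B})"
    using finite_points finite_blocks by (intro double_count) auto
  moreover have "(\<Sum>y\<in>P-{x}. card {B\<in>?Bx. y \<in> B}) = (\<Sum>y\<in>P-{x}. l)"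
    using assms pair_count by (intro sum.cong) (auto simp: conj_assoc)
  moreover have "(\<Sum>B\<in>?Bx. card {y\<in>P-{x}. y \<in> B}) = (\<Sum>B\<in>?Bx. k - 1)"
  proof (intro sum.cong refl)
    fix B assume B: "B \<in> ?Bx"
    then have "{y\<in>P-{x}. y \<in> B} = B - {x}" using block_subset by auto
    then show "card {y\<in>P-{x}. y \<in> B} = k - 1" using B card_block finite_block by simp
  qed
  ultimately show ?thesis using assms finite_points card_points by (simp add: mult.commute)
qed

text \<open>
  By \<open>replication_times\<close> the number of blocks through a point is the same for all points. As there
  are as many blocks as points, counting incident pairs shows that it equals the block size.
\<close>
lemma replication:
  assumes x: "x \<in> P"
  shows "card {B\<in>\<B>. x \<in> B} = k"
proof -
  have "(\<Sum>y\<in>P. card {B\<in>\<B>. y \<in> B}) = (\<Sum>B\<in>\<B>. card {y\<in>P. y \<in> B})"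
    using finite_points finite_blocks by (intro double_count) auto
  also have "\<dots> = (\<Sum>B\<in>\<B>. k)"
  proof (intro sum.cong refl)
    fix B assume B: "B \<in> \<B>"
    then have "{y\<in>P. y \<in> B} = B" using block_subset by auto
    then show "card {y\<in>P. y \<in> B} = k" using B card_block by simp
  qed
  also have "\<dots> = v * k" using card_blocks by simp
  finally have 1: "(\<Sum>y\<in>P. card {B\<in>\<B>. y \<in> B}) = v * k" .
  have "card {B\<in>\<B>. y \<in> B} = card {B\<in>\<B>. x \<in> B}" if "y \<in> P" for y
  proof -
    have "card {B\<in>\<B>. y \<in> B} * (k - 1) = card {B\<in>\<B>. x \<in> B} * (k - 1)"
      using replication_times[OF that] replication_times[OF x] by simp
    then show ?thesis using k_gt_1 by simp
  qed
  then have "(\<Sum>y\<in>P. card {B\<in>\<B>. y \<in> B}) = v * card {B\<in>\<B>. x \<in> B}" using card_points by simp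
  moreover have "v > 0" using x card_points finite_points card_gt_0_iff by blast
  ultimately show ?thesis using 1 by simp
qed

text \<open>
  A second moment argument: for a fixed block \<open>B\<close>, counting points and ordered pairs of points of
  \<open>B\<close> determines the sum and the sum of the squares of the intersection numbers with the other
  blocks. With these values, the squared deviations from \<open>l\<close> add up to zero.
\<close>
lemma block_intersection:
  assumes B: "B \<in> \<B>" and C: "C \<in> \<B>" and "B \<noteq> C"
  shows "card (B \<inter> C) = l"
proof -
  note finB = finite_block[OF B]
  let ?R = "\<B> - {B}"
  have finR: "finite ?R" using finite_blocks by simp
  have through: "card {D\<in>?R. x \<in> D} = k - 1" if "x \<in> B" for x
  proof -
    have "{D\<in>?R. x \<in> D} = {D\<in>\<B>. x \<in> D} - {B}" by auto
    moreover have "x \<in> P" using that B block_subset by auto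
    ultimately show ?thesis using replication B that finite_blocks by simp
  qed
  have through2: "card {D\<in>?R. x \<in> D \<and> y \<in> D} = l - 1" if "x \<in> B" "y \<in> B" "x \<noteq> y" for x y
  proof -
    have "{D\<in>?R. x \<in> D \<and> y \<in> D} = {D\<in>\<B>. x \<in> D \<and> y \<in> D} - {B}" by auto
    moreover have "x \<in> P" "y \<in> P" using that B block_subset by auto
    ultimately show ?thesis using pair_count B that finite_blocks by simp
  qed
  obtain x0 where x0: "x0 \<in> B" using card_block[OF B] k_gt_1 by fastforce
  have "card (B - {x0}) > 0" using x0 card_block[OF B] k_gt_1 finB by simp
  then obtain y0 where y0: "y0 \<in> B" "y0 \<noteq> x0" by (metis all_not_in_conv card.empty less_irrefl Diff_iff insertI1)
  have "x0 \<in> P" "y0 \<in> P" using x0 y0 B block_subset by auto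
  moreover have "card {D\<in>\<B>. x0 \<in> D \<and> y0 \<in> D} > 0"
    using x0 y0 B finite_blocks by (subst card_gt_0_iff) auto
  ultimately have l1: "l \<ge> 1" using pair_count[of x0 y0] y0 by simp
  have lv: "l * (v - 1) = k * (k - 1)"
    using replication_times[of x0] replication[of x0] x0 block_subset[OF B] by auto
  have s1: "(\<Sum>D\<in>?R. card (B \<inter> D)) = k * (k - 1)"
  proof -
    have "(\<Sum>x\<in>B. card {D\<in>?R. x \<in> D}) = (\<Sum>D\<in>?R. card {x\<in>B. x \<in> D})"
      using finB finR by (rule double_count)
    then show ?thesis using through card_block[OF B] by (simp add: Int_def)
  qed
  have s2: "(\<Sum>D\<in>?R. card (B \<inter> D) * card (B \<inter> D)) = k * (k - 1) * l"
  proof -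
    have "(\<Sum>p\<in>B\<times>B. card {D\<in>?R. fst p \<in> D \<and> snd p \<in> D})
        = (\<Sum>D\<in>?R. card {p\<in>B\<times>B. fst p \<in> D \<and> snd p \<in> D})"
      using finB finR by (intro double_count) auto
    moreover have "{p\<in>B\<times>B. fst p \<in> D \<and> snd p \<in> D} = (B \<inter> D) \<times> (B \<inter> D)" for D by auto
    moreover have "(\<Sum>p\<in>B\<times>B. card {D\<in>?R. fst p \<in> D \<and> snd p \<in> D})
        = (\<Sum>x\<in>B. \<Sum>y\<in>B. card {D\<in>?R. x \<in> D \<and> y \<in> D})"
      by (simp add: sum.cartesian_product case_prod_beta)
    moreover have "(\<Sum>y\<in>B. card {D\<in>?R. x \<in> D \<and> y \<in> D}) = (k - 1) * l" if x: "x \<in> B" for x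
    proof -
      have "(\<Sum>y\<in>B. card {D\<in>?R. x \<in> D \<and> y \<in> D})
          = card {D\<in>?R. x \<in> D} + (\<Sum>y\<in>B-{x}. card {D\<in>?R. x \<in> D \<and> y \<in> D})"
        using x finB by (subst sum.remove[of _ x]) auto
      also have "(\<Sum>y\<in>B-{x}. card {D\<in>?R. x \<in> D \<and> y \<in> D}) = (\<Sum>y\<in>B-{x}. l - 1)"
        using x by (intro sum.cong refl through2) auto
      also have "card {D\<in>?R. x \<in> D} + \<dots> = (k - 1) * l"
        using x through[OF x] card_block[OF B] finB l1 by (cases l) auto
      finally show ?thesis .
    qed
    ultimately show ?thesis using card_block[OF B] by (simp add: card_cartesian_product)
  qed
  have "(int (card (B \<inter> D)) - int l)\<^sup>2
      = int (card (B \<inter> D) * card (B \<inter> D)) - 2 * int l * int (card (B \<inter> D)) + (int l)\<^sup>2" for D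
    by (simp add: power2_eq_square algebra_simps)
  then have "(\<Sum>D\<in>?R. (int (card (B \<inter> D)) - int l)\<^sup>2)
      = (\<Sum>D\<in>?R. int (card (B \<inter> D) * card (B \<inter> D))) - 2 * int l * (\<Sum>D\<in>?R. int (card (B \<inter> D)))
        + int (card ?R) * (int l)\<^sup>2"
    by (simp only: sum.distrib sum_subtractf sum_distrib_left sum_constant of_nat_id)
  also have "\<dots> = int (k * (k - 1) * l) - 2 * int l * int (k * (k - 1)) + int (v - 1) * (int l)\<^sup>2"
    unfolding of_nat_sum[symmetric] s1 s2 using B finite_blocks card_blocks by simp
  also have "\<dots> = 0" unfolding lv[symmetric] by (simp add: power2_eq_square)
  finally have "(int (card (B \<inter> C)) - int l)\<^sup>2 = 0"
    using finR C \<open>B \<noteq> C\<close> by (subst (asm) sum_nonneg_eq_0_iff) auto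
  then show ?thesis by simp
qed

text \<open>
  Count the pairs \<open>(x, B)\<close> with both \<open>x\<close> and \<open>g x\<close> in \<open>B\<close>. A point contributes \<open>k\<close> if it is fixed
  and \<open>l\<close> otherwise. A block contributes the size of \<open>B \<inter> g ` B\<close>, which likewise is \<open>k\<close> if the
  block is fixed and \<open>l\<close> otherwise. As there are as many points as blocks and \<open>k \<noteq> l\<close>, the numbers
  of fixed points and of fixed blocks agree.
\<close>
lemma fixed_blocks_eq_fixed_points:
  assumes g: "bij_betw g P P" and aut: "(\<lambda>B. g ` B) ` \<B> = \<B>" and "l < k"
  shows "card {B\<in>\<B>. g ` B = B} = card {x\<in>P. g x = x}"
proof -
  have eq: "(\<Sum>x\<in>P. card {B\<in>\<B>. x \<in> B \<and> g x \<in> B}) = (\<Sum>B\<in>\<B>. card {x\<in>P. x \<in> B \<and> g x \<in> B})"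
    using finite_points finite_blocks by (rule double_count)
  have pts: "card {B\<in>\<B>. x \<in> B \<and> g x \<in> B} = (if g x = x then k else l)" if "x \<in> P" for x
  proof -
    have "g x \<in> P" using g that bij_betwE by blast
    then show ?thesis using replication[OF that] pair_count[OF that, of "g x"] by auto
  qed
  have blks: "card {x\<in>P. x \<in> B \<and> g x \<in> B} = (if g ` B = B then k else l)" if B: "B \<in> \<B>" for B
  proof -
    have gB: "g ` B \<in> \<B>" using aut B by auto
    \<comment> \<open>The substitution \<open>y = g x\<close> turns the contribution of \<open>B\<close> into an intersection of two blocks.\<close>
    have "g ` {x\<in>P. x \<in> B \<and> g x \<in> B} = B \<inter> g ` B" using block_subset[OF B] by auto
    moreover have "inj_on g {x\<in>P. x \<in> B \<and> g x \<in> B}"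
      using g by (auto simp: bij_betw_def inj_on_def)
    ultimately have "card {x\<in>P. x \<in> B \<and> g x \<in> B} = card (B \<inter> g ` B)"
      by (metis (no_types, lifting) card_image)
    then show ?thesis using block_intersection[OF B gB] card_block[OF B] by auto
  qed
  let ?a = "card {x\<in>P. g x = x}" and ?b = "card {B\<in>\<B>. g ` B = B}"
  have "(\<Sum>x\<in>P. if g x = x then k else l) = (\<Sum>B\<in>\<B>. if g ` B = B then k else l)"
    using eq pts blks by simp
  then have "k * ?a + l * v + l * ?b = k * ?b + l * v + l * ?a"
    using sum_two_values[OF finite_points, of "\<lambda>x. g x = x" k l]
      sum_two_values[OF finite_blocks, of "\<lambda>B. g ` B = B" k l] card_points card_blocks by simp
  then have "(int k - int l) * (int ?a - int ?b) = 0"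
    by (simp add: algebra_simps flip: of_nat_mult of_nat_add)
  then show ?thesis using \<open>l < k\<close> by simp
qed

end

section \<open>Pyramidal Hadamard designs\<close>

locale pyramidal_hadamard =
  fixes m :: nat and P :: "'a set" and \<B> :: "'a set set" and G :: "('a \<Rightarrow> 'a) set"
  assumes m_gt_1: "m > 1"
    and hadamard: "hadamard_design P \<B> m"
    and pyramidal: "pyramidal_under (2 * m - 1) P \<B> G"
begin

sublocale sym_design P \<B> "4 * m - 1" "2 * m - 1" "m - 1"
  using hadamard m_gt_1 by unfold_locales (auto simp: hadamard_design_def)

definition F :: "'a set" where "F = fixed_points G P"

definition M :: "'a set" where "M = P - F"

abbreviation "\<G> \<equiv> (AutDesign P \<B>)\<lparr>carrier := G\<rparr>"

lemma F_subset: "F \<subseteq> P" and points_Un: "P = F \<union> M" and F_M_disjoint: "F \<inter> M = {}"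
  by (auto simp: F_def M_def fixed_points_def)

lemma finite_F: "finite F" and finite_M: "finite M"
  using finite_points F_subset by (auto simp: M_def intro: finite_subset)

lemma card_F: "card F = 2 * m - 1"
  using pyramidal by (simp add: pyramidal_under_def F_def)

lemma card_M: "card M = 2 * m"
  unfolding M_def using F_subset finite_F card_F card_points m_gt_1 by (simp add: card_Diff_subset)

lemma subgroup_G: "subgroup G (AutDesign P \<B>)"
  using pyramidal by (simp add: pyramidal_under_def)

lemma G_Bij: "g \<in> G \<Longrightarrow> g \<in> Bij P" and G_blocks: "g \<in> G \<Longrightarrow> (\<lambda>B. g ` B) ` \<B> = \<B>"
  using subgroup.subset[OF subgroup_G] by (auto simp: AutDesign_def)

lemma G_bij: "g \<in> G \<Longrightarrow> bij_betw g P P" and G_extensional: "g \<in> G \<Longrightarrow> g \<in> extensional P"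
  using G_Bij by (auto simp: Bij_def)

lemma G_inj: "g \<in> G \<Longrightarrow> inj_on g P"
  using G_bij bij_betw_imp_inj_on by blast

lemma G_image_block: "g \<in> G \<Longrightarrow> B \<in> \<B> \<Longrightarrow> g ` B \<in> \<B>"
  using G_blocks by blast

lemma mult_eq: "g \<in> G \<Longrightarrow> h \<in> G \<Longrightarrow> g \<otimes>\<^bsub>AutDesign P \<B>\<^esub> h = compose P g h"
  using G_Bij by (simp add: AutDesign_def BijGroup_def)

lemma one_eq: "\<one>\<^bsub>AutDesign P \<B>\<^esub> = (\<lambda>x\<in>P. x)"
  by (simp add: AutDesign_def BijGroup_def)

lemma compose_closed: "g \<in> G \<Longrightarrow> h \<in> G \<Longrightarrow> compose P g h \<in> G"
  using subgroup.m_closed[OF subgroup_G, of g h] mult_eq[of g h] by simp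

lemma id_closed: "(\<lambda>x\<in>P. x) \<in> G"
  using subgroup.one_closed[OF subgroup_G] one_eq by simp

lemma G_fixes_F: "g \<in> G \<Longrightarrow> x \<in> F \<Longrightarrow> g x = x"
  by (auto simp: F_def fixed_points_def)

lemma G_preserves_M:
  assumes "g \<in> G" "x \<in> M"
  shows "g x \<in> M"
proof -
  have x: "x \<in> P" "x \<notin> F" using assms(2) by (auto simp: M_def)
  then have "g x \<in> P" using G_bij[OF assms(1)] bij_betwE by blast
  moreover have "g x \<notin> F"
  proof
    assume F: "g x \<in> F"
    then have "g (g x) = g x" using G_fixes_F assms(1) by blast
    then have "g x = x" using G_inj[OF assms(1)] x \<open>g x \<in> P\<close> by (auto dest: inj_onD)
    then show False using F x by simp
  qed
  ultimately show ?thesis by (simp add: M_def)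
qed

lemma regular:
  assumes "x \<in> M" "y \<in> M"
  shows "\<exists>!g. g \<in> G \<and> g x = y"
  using pyramidal assms by (auto simp: pyramidal_under_def sharply_transitive_on_def M_def F_def)

lemma orbit_bij:
  assumes x: "x \<in> M"
  shows "bij_betw (\<lambda>g. g x) G M"
proof (rule bij_betwI')
  show "(g x = h x) = (g = h)" if "g \<in> G" "h \<in> G" for g h
    using regular[OF x G_preserves_M[OF that(1) x]] that by auto
  show "\<exists>g\<in>G. y = g x" if "y \<in> M" for y
    using regular[OF x that] by auto
qed (use G_preserves_M x in auto)

lemma M_nonempty: "\<exists>x. x \<in> M"
proof (rule ccontr)
  assume "\<not> ?thesis"
  then have "card M = 0" by simp
  then show False using card_M m_gt_1 by simp
qed

lemma card_G: "card G = 2 * m" and finite_G: "finite G"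
  using M_nonempty orbit_bij card_M finite_M bij_betw_same_card bij_betw_finite by metis+

lemma fixing_moved_point:
  assumes "g \<in> G" "x \<in> M" "g x = x"
  shows "g = (\<lambda>x\<in>P. x)"
  using regular[OF assms(2,2)] assms id_closed by (auto simp: M_def)

definition stab :: "'a set \<Rightarrow> ('a \<Rightarrow> 'a) set" where
  "stab B = {g \<in> G. g ` B = B}"

text \<open>
  Exchanging the summation gives the sum over \<open>G\<close> of the numbers of fixed blocks, which are the
  numbers of fixed points: \<open>4 * m - 1\<close> for the identity and \<open>2 * m - 1\<close> for each of the
  \<open>2 * m - 1\<close> other elements.
\<close>
lemma sum_card_stab: "(\<Sum>B\<in>\<B>. card (stab B)) = 4 * m * m"
proof -
  let ?id = "\<lambda>x\<in>P. x"
  have "card {B\<in>\<B>. g ` B = B} = card {x\<in>P. g x = x}" if "g \<in> G" for g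
    using G_bij[OF that] G_blocks[OF that] m_gt_1 by (intro fixed_blocks_eq_fixed_points) auto
  then have "(\<Sum>B\<in>\<B>. card (stab B)) = (\<Sum>g\<in>G. card {x\<in>P. g x = x})"
    unfolding stab_def using double_count[OF finite_blocks finite_G, of "\<lambda>B g. g ` B = B"] by simp
  also have "\<dots> = card {x\<in>P. ?id x = x} + (\<Sum>g\<in>G-{?id}. card {x\<in>P. g x = x})"
    using finite_G id_closed by (simp add: sum.remove)
  also have "{x\<in>P. ?id x = x} = P" by auto
  also have "(\<Sum>g\<in>G-{?id}. card {x\<in>P. g x = x}) = (\<Sum>g\<in>G-{?id}. card F)"
  proof (intro sum.cong refl arg_cong[where f = card])
    fix g assume g: "g \<in> G - {?id}"
    then show "{x\<in>P. g x = x} = F"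
      using fixing_moved_point[of g] G_fixes_F[of g] points_Un by auto
  qed
  also have "card P + \<dots> = 4 * m * m"
  proof -
    obtain q where "m = Suc q" using m_gt_1 by (cases m) auto
    then show ?thesis
      using card_points card_F card_G id_closed finite_G by (simp add: algebra_simps)
  qed
  finally show ?thesis .
qed

text \<open>
  A block fixed by \<open>G\<close> contains all or nothing of the orbit \<open>M\<close>, and \<open>M\<close> has one point too many
  to lie in a block.
\<close>
lemma moving_element:
  assumes "B \<in> \<B>" "B \<noteq> F"
  shows "\<exists>g\<in>G. g ` B \<noteq> B"
proof (rule ccontr)
  assume "\<not> ?thesis"
  then have fixed: "\<And>g. g \<in> G \<Longrightarrow> g ` B = B" by blast
  show False
  proof (cases "B \<inter> M = {}")
    case True
    then have "B \<subseteq> F" using block_subset[OF assms(1)] points_Un by blast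
    then show False
      using assms card_subset_eq[OF finite_F] card_block card_F by metis
  next
    case False
    then obtain x where x: "x \<in> B" "x \<in> M" by blast
    have "M \<subseteq> B"
    proof
      fix y assume "y \<in> M"
      then obtain g where "g \<in> G" "g x = y" using regular x by blast
      then show "y \<in> B" using fixed x by blast
    qed
    then have "card M \<le> card B" using finite_block assms(1) card_mono by blast
    then show False using card_M card_block[OF assms(1)] m_gt_1 by simp
  qed
qed

text \<open>
  The stabilizer is proper, and multiplication by an element that moves \<open>B\<close> maps it injectively to
  its complement in \<open>G\<close>.
\<close>
lemma card_stab_le:
  assumes B: "B \<in> \<B>" "B \<noteq> F"
  shows "card (stab B) \<le> m"
proof -
  obtain g where g: "g \<in> G" "g ` B \<noteq> B" using moving_element[OF B] by blast
  have img: "compose P g h ` B = g ` B" if "h \<in> stab B" for h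
  proof -
    have "compose P g h ` B = g ` (h ` B)"
      using block_subset[OF B(1)] by (auto simp: compose_def image_image subset_iff)
    then show ?thesis using that by (simp add: stab_def)
  qed
  have "inj_on (compose P g) (stab B)"
  proof (rule inj_onI)
    fix h h' assume h: "h \<in> stab B" "h' \<in> stab B" and eq: "compose P g h = compose P g h'"
    then have hG: "h \<in> G" "h' \<in> G" by (auto simp: stab_def)
    show "h = h'"
    proof (rule extensionalityI[OF G_extensional[OF hG(1)] G_extensional[OF hG(2)]])
      fix x assume x: "x \<in> P"
      then have "g (h x) = g (h' x)" using fun_cong[OF eq, of x] by (simp add: compose_def)
      moreover have "h x \<in> P" "h' x \<in> P" using x hG G_bij bij_betwE by blast+
      ultimately show "h x = h' x" using G_inj[OF g(1)] by (auto dest: inj_onD)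
    qed
  qed
  moreover have "compose P g ` stab B \<subseteq> G - stab B"
  proof
    fix f assume "f \<in> compose P g ` stab B"
    then obtain h where h: "h \<in> stab B" "f = compose P g h" by blast
    then have "f \<in> G" using compose_closed[OF g(1)] by (simp add: stab_def)
    then show "f \<in> G - stab B" using img h g by (simp add: stab_def)
  qed
  ultimately have "card (stab B) \<le> card (G - stab B)"
    using finite_G by (intro card_inj_on_le) auto
  also have "\<dots> = card G - card (stab B)"
    using finite_G by (intro card_Diff_subset) (auto simp: stab_def)
  finally show ?thesis using card_G by simp
qed

text \<open>
  Otherwise no block is fixed by \<open>G\<close>, and the \<open>4 * m - 1\<close> stabilizers, of order at most \<open>m\<close> each,
  fall short of the total order in \<open>sum_card_stab\<close>.
\<close>
lemma F_block: "F \<in> \<B>"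
proof (rule ccontr)
  assume "F \<notin> \<B>"
  then have "(\<Sum>B\<in>\<B>. card (stab B)) \<le> (\<Sum>B\<in>\<B>. m)"
    using card_stab_le by (intro sum_mono) auto
  then have "4 * m * m \<le> (4 * m - 1) * m" using sum_card_stab card_blocks by simp
  moreover obtain q where "m = Suc q" using m_gt_1 by (cases m) auto
  ultimately show False by (simp add: algebra_simps)
qed

text \<open>
  Once \<open>F\<close>, whose stabilizer has order at most \<open>2 * m\<close>, is accounted for, the total of
  \<open>sum_card_stab\<close> leaves the average value \<open>m\<close> for the other blocks, which is also their maximum.
\<close>
lemma card_stab:
  assumes B: "B \<in> \<B>" "B \<noteq> F"
  shows "card (stab B) = m"
proof (rule ccontr)
  assume "card (stab B) \<noteq> m"
  then have "(\<Sum>C\<in>\<B>-{F}. card (stab C)) < (\<Sum>C\<in>\<B>-{F}. m)"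
    using B card_stab_le finite_blocks by (intro sum_strict_mono_ex1) (auto simp: order_less_le)
  moreover have "(\<Sum>C\<in>\<B>. card (stab C)) = card (stab F) + (\<Sum>C\<in>\<B>-{F}. card (stab C))"
    using finite_blocks F_block by (simp add: sum.remove)
  moreover have "card (stab F) \<le> 2 * m"
    unfolding card_G[symmetric] using finite_G by (intro card_mono) (auto simp: stab_def)
  moreover have "(\<Sum>C\<in>\<B>-{F}. m) = (4 * m - 2) * m"
    using F_block finite_blocks card_blocks by (simp add: numeral_2_eq_2)
  ultimately have "4 * m * m < 2 * m + (4 * m - 2) * m"
    using sum_card_stab by linarith
  moreover obtain q where "m = Suc q" using m_gt_1 by (cases m) auto
  ultimately show False by (simp add: algebra_simps)
qed

text \<open>\<open>F\<close> is itself a block, so the trace of any other block on it has \<open>m - 1\<close> points.\<close>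
lemma card_block_Int:
  assumes B: "B \<in> \<B>" "B \<noteq> F"
  shows "card (B \<inter> F) = m - 1" and "card (B \<inter> M) = m" and "card (F - B) = m" and "card (M - B) = m"
proof -
  show F: "card (B \<inter> F) = m - 1" using block_intersection[OF B(1) F_block B(2)] .
  have "B = (B \<inter> F) \<union> (B \<inter> M)" using block_subset[OF B(1)] points_Un by blast
  then have "card B = card (B \<inter> F) + card (B \<inter> M)"
    using finite_F finite_M F_M_disjoint by (metis Int_assoc Int_left_commute Int_empty_right card_Un_disjoint finite_Int)
  then show M: "card (B \<inter> M) = m" using F card_block[OF B(1)] m_gt_1 by simp
  show "card (F - B) = m" using F card_F m_gt_1 finite_F by (simp add: card_Diff_subset_Int Int_commute)
  show "card (M - B) = m" using M card_M finite_M by (simp add: card_Diff_subset_Int Int_commute)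
qed

text \<open>
  For \<open>x\<close> in \<open>B \<inter> M\<close>, the orbit of \<open>x\<close> under the stabilizer of \<open>B\<close> lies in \<open>B \<inter> M\<close> and has the same
  size \<open>m\<close>. By regularity, an element that takes \<open>x\<close> back into \<open>B\<close> then lies in the stabilizer.
  So \<open>g\<close> maps \<open>B \<inter> M\<close> into \<open>M - B\<close>, which has the same size again.
\<close>
lemma image_moved_part:
  assumes B: "B \<in> \<B>" "B \<noteq> F" and g: "g \<in> G" "g ` B \<noteq> B"
  shows "g ` (B \<inter> M) = M - B"
proof (rule card_subset_eq)
  show "finite (M - B)" using finite_M by simp
  show "g ` (B \<inter> M) \<subseteq> M - B"
  proof
    fix y assume "y \<in> g ` (B \<inter> M)"
    then obtain x where x: "x \<in> B" "x \<in> M" and y: "y = g x" by blast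
    have "y \<notin> B"
    proof
      assume "y \<in> B"
      have orbit: "(\<lambda>h. h x) ` stab B = B \<inter> M"
      proof (rule card_subset_eq)
        show "finite (B \<inter> M)" using finite_M by simp
        show "(\<lambda>h. h x) ` stab B \<subseteq> B \<inter> M" using x G_preserves_M by (auto simp: stab_def)
        have "inj_on (\<lambda>h. h x) (stab B)"
          by (rule inj_on_subset[OF bij_betw_imp_inj_on[OF orbit_bij[OF x(2)]]]) (auto simp: stab_def)
        then show "card ((\<lambda>h. h x) ` stab B) = card (B \<inter> M)"
          using card_stab[OF B] card_block_Int(2)[OF B] by (simp add: card_image)
      qed
      have "y \<in> M" using y x g G_preserves_M by blast
      then have "g x \<in> (\<lambda>h. h x) ` stab B" using y \<open>y \<in> B\<close> unfolding orbit by simp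
      then obtain h where h: "h \<in> stab B" "h x = g x" by (metis imageE)
      then have "h = g"
        using bij_betw_imp_inj_on[OF orbit_bij[OF x(2)]] g by (auto simp: stab_def dest: inj_onD)
      then show False using h g by (simp add: stab_def)
    qed
    then show "y \<in> M - B" using y x g G_preserves_M by blast
  qed
  have "inj_on g (B \<inter> M)" using G_inj[OF g(1)] by (rule inj_on_subset) (auto simp: M_def)
  then show "card (g ` (B \<inter> M)) = card (M - B)" using card_block_Int[OF B] by (simp add: card_image)
qed

text \<open>
  Each \<open>B\<close> defines a homomorphism from \<open>G\<close> to the group of order two, with the stabilizer as its
  kernel, and the partition of \<open>M\<close> by \<open>B\<close> transforms according to it. All algebraic properties of
  \<open>G\<close> below are read off from this equivalence.
\<close>
lemma mem_block_iff:
  assumes B: "B \<in> \<B>" "B \<noteq> F" and g: "g \<in> G" and x: "x \<in> M"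
  shows "g x \<in> B \<longleftrightarrow> (x \<in> B \<longleftrightarrow> g ` B = B)"
proof -
  have reflects: "x \<in> A" if "g x \<in> g ` A" "A \<subseteq> P" for A
    using that G_inj[OF g] x by (auto simp: M_def dest: inj_onD)
  show ?thesis
  proof (cases "g ` B = B")
    case True
    then show ?thesis using reflects[of B] block_subset[OF B(1)] by blast
  next
    case False
    have img: "g ` (B \<inter> M) = M - B" using image_moved_part[OF B g False] .
    moreover have "g x \<in> M" using G_preserves_M g x by blast
    moreover have "B \<inter> M \<subseteq> P" by (auto simp: M_def)
    ultimately show ?thesis using reflects[of "B \<inter> M"] x False by blast
  qed
qed

text \<open>
  More blocks pass through a point than through a pair of points, and no block through a point of \<open>M\<close>
  is \<open>F\<close>.
\<close>
lemma separated_eq: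
  assumes "x \<in> M" "y \<in> M" and same: "\<And>B. B \<in> \<B> \<Longrightarrow> B \<noteq> F \<Longrightarrow> x \<in> B \<longleftrightarrow> y \<in> B"
  shows "x = y"
proof (rule ccontr)
  assume "x \<noteq> y"
  have P: "x \<in> P" "y \<in> P" "x \<notin> F" using assms by (auto simp: M_def)
  have "{B\<in>\<B>. x \<in> B \<and> y \<in> B} = {B\<in>\<B>. x \<in> B}" using same P by blast
  then show False using replication[OF P(1)] pair_count[OF P(1,2) \<open>x \<noteq> y\<close>] m_gt_1 by simp
qed

text \<open>
  By \<open>mem_block_iff\<close>, the sides of \<open>g (g x)\<close> and \<open>x\<close> agree for every block, as do the sides of
  \<open>g (h x)\<close> and \<open>h (g x)\<close>: the criterion is symmetric in \<open>g\<close> and \<open>h\<close>.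
\<close>
lemma compose_self:
  assumes g: "g \<in> G"
  shows "compose P g g = (\<lambda>x\<in>P. x)"
proof -
  obtain x where x: "x \<in> M" using M_nonempty by blast
  have "g (g x) = x"
    using x g by (intro separated_eq) (auto simp: G_preserves_M mem_block_iff)
  then show ?thesis using x compose_closed[OF g g] by (intro fixing_moved_point) (auto simp: compose_def M_def)
qed

lemma compose_commute:
  assumes g: "g \<in> G" and h: "h \<in> G"
  shows "compose P g h = compose P h g"
proof -
  obtain x where x: "x \<in> M" using M_nonempty by blast
  have "g (h x) = h (g x)"
    using x g h by (intro separated_eq) (auto simp: G_preserves_M mem_block_iff)
  then have "compose P g h x = compose P h g x" using x by (simp add: compose_def M_def)
  then show ?thesis
    using inj_onD[OF bij_betw_imp_inj_on[OF orbit_bij[OF x]]] compose_closed g h by blast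
qed

lemma comm_group_G: "comm_group \<G>"
proof (rule comm_groupI)
  fix g h f assume "g \<in> carrier \<G>" "h \<in> carrier \<G>" "f \<in> carrier \<G>"
  then have G: "g \<in> G" "h \<in> G" "f \<in> G" by auto
  show "g \<otimes>\<^bsub>\<G>\<^esub> h \<otimes>\<^bsub>\<G>\<^esub> f = g \<otimes>\<^bsub>\<G>\<^esub> (h \<otimes>\<^bsub>\<G>\<^esub> f)"
    using G by (simp add: mult_eq compose_closed compose_assoc[OF Bij_imp_funcset[OF G_Bij[OF G(3)]]])
next
  fix g h assume "g \<in> carrier \<G>" "h \<in> carrier \<G>"
  then have G: "g \<in> G" "h \<in> G" by auto
  show "g \<otimes>\<^bsub>\<G>\<^esub> h \<in> carrier \<G>" using G compose_closed mult_eq by simp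
  show "g \<otimes>\<^bsub>\<G>\<^esub> h = h \<otimes>\<^bsub>\<G>\<^esub> g" using G compose_commute mult_eq by simp
next
  show "\<one>\<^bsub>\<G>\<^esub> \<in> carrier \<G>" using id_closed one_eq by simp
next
  fix g assume "g \<in> carrier \<G>"
  then have G: "g \<in> G" by simp
  then show "\<one>\<^bsub>\<G>\<^esub> \<otimes>\<^bsub>\<G>\<^esub> g = g"
    using id_closed Bij_imp_funcset[OF G_Bij[OF G]] G_extensional by (simp add: one_eq mult_eq)
  show "\<exists>h\<in>carrier \<G>. h \<otimes>\<^bsub>\<G>\<^esub> g = \<one>\<^bsub>\<G>\<^esub>"
    using G compose_self mult_eq one_eq by auto
qed

lemma mult_self: "g \<in> carrier \<G> \<Longrightarrow> g \<otimes>\<^bsub>\<G>\<^esub> g = \<one>\<^bsub>\<G>\<^esub>"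
  using compose_self mult_eq one_eq by simp

lemma elementary_abelian_G: "elementary_abelian 2 \<G>"
proof -
  interpret \<G>: comm_group \<G> by (rule comm_group_G)
  have "g [^]\<^bsub>\<G>\<^esub> (2::nat) = \<one>\<^bsub>\<G>\<^esub>" if "g \<in> carrier \<G>" for g
    unfolding numeral_2_eq_2 \<G>.nat_pow_Suc \<G>.nat_pow_0 \<G>.l_one[OF that] by (rule mult_self[OF that])
  then show ?thesis
    unfolding elementary_abelian_def using comm_group_G two_is_prime_nat by blast
qed

text \<open>
  For \<open>B \<noteq> F\<close> this is the other block in the orbit of \<open>B\<close> under \<open>G\<close>. The explicit form shows that it
  depends only on \<open>B\<close> and that it is an involution.
\<close>
definition twist :: "'a set \<Rightarrow> 'a set" where
  "twist B = (F \<inter> B) \<union> (M - B)"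

lemma twist_block:
  assumes B: "B \<in> \<B>" "B \<noteq> F"
  shows "twist B \<in> \<B>"
proof -
  obtain g where g: "g \<in> G" "g ` B \<noteq> B" using moving_element[OF B] by blast
  have "g ` B = g ` (B \<inter> F) \<union> g ` (B \<inter> M)"
    using block_subset[OF B(1)] points_Un by blast
  also have "g ` (B \<inter> F) = F \<inter> B" using G_fixes_F[OF g(1)] by force
  finally have "g ` B = twist B" using image_moved_part[OF B g] by (simp add: twist_def)
  then show ?thesis using G_image_block[OF g(1) B(1)] by simp
qed

lemma twist_twist: "B \<subseteq> P \<Longrightarrow> twist (twist B) = B"
  using points_Un F_M_disjoint by (auto simp: twist_def)

lemma twist_neq_F:
  assumes "B \<in> \<B>" "B \<noteq> F"
  shows "twist B \<noteq> F"
proof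
  assume "twist B = F"
  then have "M - B = {}" using F_M_disjoint by (auto simp: twist_def)
  then show False using card_block_Int(4)[OF assms] m_gt_1 by (metis card.empty not_one_less_zero)
qed

text \<open>
  For \<open>z\<close> in \<open>M\<close>, these blocks are representatives of the pairs \<open>{B, twist B}\<close>, by \<open>blocks_eq\<close>.
\<close>

definition star :: "'a \<Rightarrow> 'a set set" where
  "star z = {B \<in> \<B>. z \<in> B}"

lemma star_block: "z \<in> M \<Longrightarrow> B \<in> star z \<Longrightarrow> B \<in> \<B> \<and> B \<noteq> F"
  using F_M_disjoint by (auto simp: star_def)

lemma finite_star: "finite (star z)"
  using finite_blocks by (simp add: star_def)

lemma card_star: "z \<in> M \<Longrightarrow> card (star z) = 2 * m - 1"
  using replication[of z] by (simp add: star_def M_def)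

lemma inj_twist: "\<A> \<subseteq> \<B> \<Longrightarrow> inj_on twist \<A>"
  by (rule inj_on_inverseI[where g = twist]) (intro twist_twist block_subset, blast)

lemma blocks_eq:
  assumes z: "z \<in> M"
  shows "\<B> = insert F (star z \<union> twist ` star z)"
proof -
  have "B \<in> star z \<union> twist ` star z" if B: "B \<in> \<B>" "B \<noteq> F" for B
  proof (cases "z \<in> B")
    case False
    then have "twist B \<in> star z" using twist_block[OF B] z by (auto simp: star_def twist_def)
    then show ?thesis using twist_twist[OF block_subset[OF B(1)]] by (metis UnI2 imageI)
  qed (use B in \<open>simp add: star_def\<close>)
  then show ?thesis using F_block star_block[OF z] twist_block by blast
qed

text \<open>
  Two distinct blocks meet in \<open>m - 1\<close> points. A common trace on \<open>F\<close> has that size already, so no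
  room is left for the common point \<open>z\<close>; in the next lemma, a common trace on \<open>M\<close> is too large.
\<close>
lemma inj_fixed_trace:
  assumes z: "z \<in> M"
  shows "inj_on (\<lambda>B. F - B) (star z)"
proof (rule inj_onI, rule ccontr)
  fix B C assume B: "B \<in> star z" and C: "C \<in> star z" and eq: "F - B = F - C" and "B \<noteq> C"
  have B': "B \<in> \<B>" "B \<noteq> F" and C': "C \<in> \<B>" "C \<noteq> F" using star_block[OF z] B C by auto
  have "B \<inter> F \<subseteq> B \<inter> C" using eq by blast
  moreover have "card (B \<inter> F) = card (B \<inter> C)"
    using card_block_Int(1)[OF B'] block_intersection[OF B'(1) C'(1) \<open>B \<noteq> C\<close>] by simp
  ultimately have "B \<inter> F = B \<inter> C" using finite_block[OF B'(1)] by (intro card_subset_eq) auto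
  then show False using z B C F_M_disjoint by (auto simp: star_def)
qed

lemma inj_moved_trace:
  assumes z: "z \<in> M"
  shows "inj_on (\<lambda>B. M - B) (star z)"
proof (rule inj_onI, rule ccontr)
  fix B C assume B: "B \<in> star z" and C: "C \<in> star z" and eq: "M - B = M - C" and "B \<noteq> C"
  have B': "B \<in> \<B>" "B \<noteq> F" and C': "C \<in> \<B>" "C \<noteq> F" using star_block[OF z] B C by auto
  have "card (B \<inter> M) \<le> card (B \<inter> C)"
    using eq finite_block[OF B'(1)] by (intro card_mono) auto
  then show False
    using card_block_Int(2)[OF B'] block_intersection[OF B'(1) C'(1) \<open>B \<noteq> C\<close>] m_gt_1 by simp
qed

text \<open>
  Let \<open>N\<close> and \<open>T\<close> be the sets of blocks through \<open>z\<close> that avoid, respectively contain, both \<open>x\<close> and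
  \<open>y\<close>. Inclusion and exclusion gives \<open>card N = card T + 1\<close>. A second equation comes from the
  \<open>m - 1\<close> blocks through \<open>x\<close> and \<open>y\<close>: they are the members of \<open>T\<close> together with twisted blocks. On
  points of \<open>F\<close> twisting changes nothing, which gives \<open>F\<close> and twice \<open>T\<close>; on points of \<open>M\<close> it
  exchanges containing and avoiding, which gives \<open>T\<close> and \<open>N\<close>. Either way \<open>2 * card N = m\<close>.
\<close>
lemma card_star_avoiding:
  assumes z: "z \<in> M" and "x \<noteq> y" and xy: "x \<in> F \<and> y \<in> F \<or> x \<in> M - {z} \<and> y \<in> M - {z}"
  shows "2 * card {B\<in>star z. x \<notin> B \<and> y \<notin> B} = m"
proof -
  let ?N = "{B\<in>star z. x \<notin> B \<and> y \<notin> B}" and ?T = "{B\<in>star z. x \<in> B \<and> y \<in> B}"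
  have P: "x \<in> P" "y \<in> P" "z \<in> P" "x \<noteq> z" "y \<noteq> z" using z xy points_Un F_M_disjoint by auto
  have X: "card {B\<in>star z. x \<in> B} = m - 1" and Y: "card {B\<in>star z. y \<in> B} = m - 1"
    using pair_count[of z x] pair_count[of z y] P by (auto simp: star_def conj_assoc)
  have fin: "finite {B\<in>star z. Q B}" for Q using finite_star by simp
  have "card (star z) = card ?N + card ({B\<in>star z. x \<in> B} \<union> {B\<in>star z. y \<in> B})"
    using fin by (subst card_Un_disjoint[symmetric]) (auto intro: arg_cong[where f = card])
  moreover have "card ({B\<in>star z. x \<in> B} \<union> {B\<in>star z. y \<in> B}) + card ?T = (m - 1) + (m - 1)"
  proof -
    have "{B\<in>star z. x \<in> B} \<inter> {B\<in>star z. y \<in> B} = ?T" by auto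
    then show ?thesis using card_Un_Int[of "{B\<in>star z. x \<in> B}" "{B\<in>star z. y \<in> B}"] fin X Y by simp
  qed
  ultimately have N: "card ?N = card ?T + 1" using card_star[OF z] m_gt_1 by simp
  have all: "card {B\<in>\<B>. x \<in> B \<and> y \<in> B} = m - 1" using pair_count P \<open>x \<noteq> y\<close> by blast
  have sub: "star z \<subseteq> \<B>" by (auto simp: star_def)
  have off: "z \<notin> twist B" if "B \<in> star z" for B using that z F_M_disjoint by (auto simp: twist_def star_def)
  have cardtw: "card (twist ` {B\<in>star z. Q B}) = card {B\<in>star z. Q B}" for Q
    using sub by (intro card_image inj_twist) auto
  have disj: "?T \<inter> twist ` {B\<in>star z. Q B} = {}" for Q using off by (auto simp: star_def)
  from xy show ?thesis
  proof
    assume F: "x \<in> F \<and> y \<in> F"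
    have "{B\<in>\<B>. x \<in> B \<and> y \<in> B} = insert F (?T \<union> twist ` ?T)"
      using F by (subst blocks_eq[OF z]) (auto simp: twist_def M_def)
    moreover have "F \<notin> ?T \<union> twist ` ?T" using star_block[OF z] twist_neq_F by blast
    ultimately have "card {B\<in>\<B>. x \<in> B \<and> y \<in> B} = 1 + (card ?T + card ?T)"
      using fin disj cardtw by (simp add: card_Un_disjoint)
    then show ?thesis using all N m_gt_1 by simp
  next
    assume M: "x \<in> M - {z} \<and> y \<in> M - {z}"
    have "{B\<in>\<B>. x \<in> B \<and> y \<in> B} = ?T \<union> twist ` ?N"
      using M F_M_disjoint by (subst blocks_eq[OF z]) (auto simp: twist_def)
    then have "card {B\<in>\<B>. x \<in> B \<and> y \<in> B} = card ?T + card ?N"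
      using fin disj cardtw by (simp add: card_Un_disjoint)
    then show ?thesis using all N m_gt_1 by simp
  qed
qed

text \<open>
  The set \<open>T\<close> allows the blocks \<open>M - B\<close> on \<open>M - {z}\<close>, where \<open>T = M\<close> is larger than the point set \<open>S\<close>;
  on \<open>F\<close>, both are \<open>F\<close>.
\<close>
lemma trace_design:
  assumes z: "z \<in> M" and S: "S \<subseteq> F \<or> S \<subseteq> M - {z}" and "card S = 2 * m - 1"
    and inj: "inj_on (\<lambda>B. T - B) (star z)"
    and T: "\<And>B. B \<in> star z \<Longrightarrow> T - B = S - B" and card: "\<And>B. B \<in> star z \<Longrightarrow> card (T - B) = m"
  shows "symmetric_design S ((\<lambda>B. T - B) ` star z) (2 * m - 1) m (m div 2)"
proof -
  let ?D = "(\<lambda>B. T - B) ` star z"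
  have "finite S" using S finite_F finite_M finite_subset by (metis finite_Diff)
  moreover have "card {X\<in>?D. x \<in> X \<and> y \<in> X} = m div 2" if xy: "x \<in> S" "y \<in> S" "x \<noteq> y" for x y
  proof -
    have "{X\<in>?D. x \<in> X \<and> y \<in> X} = (\<lambda>B. T - B) ` {B\<in>star z. x \<notin> B \<and> y \<notin> B}"
      using xy T by auto
    then have "card {X\<in>?D. x \<in> X \<and> y \<in> X} = card {B\<in>star z. x \<notin> B \<and> y \<notin> B}"
      using inj by (simp add: card_image inj_on_subset)
    moreover have "2 * card {B\<in>star z. x \<notin> B \<and> y \<notin> B} = m"
      using xy S by (intro card_star_avoiding[OF z]) auto
    ultimately show ?thesis by simp
  qed
  moreover have "card ?D = 2 * m - 1" using inj card_star[OF z] by (simp add: card_image)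
  ultimately show ?thesis
    unfolding symmetric_design_def design_def using assms(3) T card by auto
qed

lemma fixed_design:
  assumes z: "z \<in> M"
  shows "symmetric_design F ((\<lambda>B. F - B) ` star z) (2 * m - 1) m (m div 2)"
proof (rule trace_design[OF z _ card_F inj_fixed_trace[OF z] refl])
  show "card (F - B) = m" if "B \<in> star z" for B
    using card_block_Int(3) star_block[OF z that] by blast
qed simp

lemma moved_design:
  assumes z: "z \<in> M"
  shows "symmetric_design (M - {z}) ((\<lambda>B. M - B) ` star z) (2 * m - 1) m (m div 2)"
proof (rule trace_design[OF z _ _ inj_moved_trace[OF z]])
  show "card (M - {z}) = 2 * m - 1" using z finite_M card_M by simp
  show "M - B = M - {z} - B" if "B \<in> star z" for B using that by (auto simp: star_def)
  show "card (M - B) = m" if "B \<in> star z" for B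
    using card_block_Int(4) star_block[OF z that] by blast
qed simp

lemma power_of_two_parameters:
  assumes "2 * m = 2 ^ k" "k > 1"
  shows "2 * m - 1 = 2 ^ k - 1" and "m = 2 ^ (k - 1)" and "m div 2 = 2 ^ (k - 2)"
proof -
  have "k = Suc (Suc (k - 2))" using assms(2) by simp
  then obtain j where j: "k = Suc (Suc j)" by blast
  show "2 * m - 1 = 2 ^ k - 1" "m = 2 ^ (k - 1)" "m div 2 = 2 ^ (k - 2)"
    using assms(1) unfolding j by simp_all
qed

text \<open>
  The summand blocks \<open>F - B\<close> and \<open>M - B\<close> belong to the same block \<open>B\<close> through \<open>z\<close>, and this
  correspondence is the bijection of the sum. The complement of \<open>B\<close> is then \<open>X \<union> \<delta> X\<close>, that of
  \<open>twist B\<close> is \<open>X \<union> (M - \<delta> X)\<close>, and that of \<open>F\<close> is the distinguished block \<open>M\<close>.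
\<close>
lemma complement_sum:
  assumes z: "z \<in> M" and k: "2 * m = 2 ^ k" "k > 1"
  shows "sum_of_designs (k + 1) P (complement_blocks P \<B>)
           F ((\<lambda>B. F - B) ` star z) (M - {z}) ((\<lambda>B. M - B) ` star z)"
proof -
  let ?\<delta> = "(\<lambda>B. M - B) \<circ> inv_into (star z) (\<lambda>B. F - B)"
  have \<delta>: "?\<delta> (F - B) = M - B" if "B \<in> star z" for B
    using that inj_fixed_trace[OF z] by simp
  have bij: "bij_betw ?\<delta> ((\<lambda>B. F - B) ` star z) ((\<lambda>B. M - B) ` star z)"
    using inj_fixed_trace[OF z] inj_moved_trace[OF z]
    by (intro bij_betw_trans[OF bij_betw_inv_into]) (auto simp: bij_betw_def)
  have c1: "P - B = (F - B) \<union> (M - B)" for B using points_Un by blast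
  have c2: "P - twist B = (F - B) \<union> (M - (M - B))" for B
    using points_Un F_M_disjoint by (auto simp: twist_def)
  have "complement_blocks P \<B> = insert (P - F) ((\<lambda>B. P - B) ` star z \<union> (\<lambda>B. P - twist B) ` star z)"
    unfolding complement_blocks_def by (subst blocks_eq[OF z]) blast
  also have "\<dots> = {M} \<union> {X \<union> ?\<delta> X |X. X \<in> (\<lambda>B. F - B) ` star z}
      \<union> {X \<union> (M - ?\<delta> X) |X. X \<in> (\<lambda>B. F - B) ` star z}"
  proof -
    have "(\<lambda>B. P - B) ` star z = (\<lambda>X. X \<union> ?\<delta> X) ` (\<lambda>B. F - B) ` star z"
      unfolding image_image by (intro image_cong refl) (simp only: c1 \<delta>)
    moreover have "(\<lambda>B. P - twist B) ` star z = (\<lambda>X. X \<union> (M - ?\<delta> X)) ` (\<lambda>B. F - B) ` star z"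
      unfolding image_image by (intro image_cong refl) (simp only: c2 \<delta>)
    moreover have "P - F = M" by (simp add: M_def)
    ultimately show ?thesis unfolding Setcompr_eq_image by simp
  qed
  finally have "\<exists>\<delta>. bij_betw \<delta> ((\<lambda>B. F - B) ` star z) ((\<lambda>B. M - B) ` star z) \<and>
      complement_blocks P \<B> = {M} \<union> {X \<union> \<delta> X |X. X \<in> (\<lambda>B. F - B) ` star z}
        \<union> {X \<union> (M - \<delta> X) |X. X \<in> (\<lambda>B. F - B) ` star z}"
    using bij by blast
  moreover have "M \<subset> P"
  proof -
    have "F \<noteq> {}" using card_F m_gt_1 by auto
    then show ?thesis using F_subset by (auto simp: M_def)
  qed
  moreover have "F = P - M" "M - {z} \<subset> M" using z points_Un F_M_disjoint by auto
  moreover have "card (M - {z}) = 2 ^ (k + 1 - 1) - 1" using z card_M finite_M k by simp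
  moreover have "card M = 2 ^ (k + 1 - 1)" using card_M k by simp
  moreover have "card P = 2 ^ (k + 1) - 1" using card_points k by simp
  moreover have "symmetric_design F ((\<lambda>B. F - B) ` star z) (2 ^ (k + 1 - 1) - 1) (2 ^ (k + 1 - 2)) (2 ^ (k + 1 - 3))"
    "symmetric_design (M - {z}) ((\<lambda>B. M - B) ` star z) (2 ^ (k + 1 - 1) - 1) (2 ^ (k + 1 - 2)) (2 ^ (k + 1 - 3))"
    using fixed_design[OF z] moved_design[OF z] power_of_two_parameters[OF k]
    by (simp_all add: numeral_2_eq_2 numeral_3_eq_3)
  moreover have "k + 1 \<ge> 3" using k(2) by simp
  ultimately show ?thesis
    unfolding sum_of_designs_def by - (intro conjI exI[of _ M]; assumption)
qed

end

section \<open>Binary vectors and hyperplanes\<close>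

lemma bitvec_add_self: "u + u = (0 :: nat \<Rightarrow> bit)"
  by (simp add: fun_eq_iff)

lemma bitvec_add_eq_0_iff: "u + w = 0 \<longleftrightarrow> u = (w :: nat \<Rightarrow> bit)"
  by (metis add.commute add.right_neutral add_left_cancel bitvec_add_self)

lemma bitvec_add_cancel: "u + (u + w) = (w :: nat \<Rightarrow> bit)"
  by (metis add.assoc add.left_neutral bitvec_add_self)

lemma bit_scale_cases: "bit_scale c w = 0 \<or> bit_scale c w = w"
  by (cases c) (auto simp: bit_scale_def fun_eq_iff)

lemma subspace_iff_add_closed:
  "bitvec.subspace W \<longleftrightarrow> 0 \<in> W \<and> (\<forall>u\<in>W. \<forall>w\<in>W. u + w \<in> W)"
  unfolding bitvec.subspace_def using bit_scale_cases by metis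

lemma bitvec_diff_scale: "x - bit_scale 0 a = x" "x - bit_scale 1 a = a + x"
proof -
  show "x - bit_scale 0 a = x" by (simp add: fun_eq_iff bit_scale_def)
  show "x - bit_scale 1 a = a + x"
  proof
    fix i show "(x - bit_scale 1 a) i = (a + x) i"
      by (cases "x i"; cases "a i") (simp_all add: bit_scale_def)
  qed
qed

lemma span_insert_eq_Un:
  "bitvec.span (insert a S) = bitvec.span S \<union> (+) a ` bitvec.span S"
proof -
  have "x \<in> bitvec.span (insert a S) \<longleftrightarrow> x \<in> bitvec.span S \<or> a + x \<in> bitvec.span S" for x
  proof -
    have "x \<in> bitvec.span (insert a S) \<longleftrightarrow> (\<exists>c. x - bit_scale c a \<in> bitvec.span S)"
      by (simp only: bitvec.span_insert mem_Collect_eq)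
    also have "\<dots> \<longleftrightarrow> x - bit_scale 0 a \<in> bitvec.span S \<or> x - bit_scale 1 a \<in> bitvec.span S"
      by (metis (full_types) bit.exhaust)
    finally show ?thesis unfolding bitvec_diff_scale .
  qed
  moreover have "a + x \<in> bitvec.span S \<longleftrightarrow> x \<in> (+) a ` bitvec.span S" for x
  proof
    assume "a + x \<in> bitvec.span S"
    then show "x \<in> (+) a ` bitvec.span S"
      by (rule image_eqI[rotated]) (simp add: bitvec_add_cancel)
  qed (auto simp: bitvec_add_cancel)
  ultimately show ?thesis by blast
qed

text \<open>Each new independent vector adds one disjoint translate of the span so far.\<close>
lemma card_span_independent:
  assumes "finite S" "bitvec.independent S"
  shows "finite (bitvec.span S) \<and> card (bitvec.span S) = 2 ^ card S"
  using assms
proof (induction S)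
  case empty
  then show ?case by simp
next
  case (insert a S)
  then have ind: "bitvec.independent S" and a: "a \<notin> bitvec.span S"
    by (auto simp: bitvec.independent_insert)
  have IH: "finite (bitvec.span S)" "card (bitvec.span S) = 2 ^ card S" using insert.IH[OF ind] by auto
  have "a + x \<notin> bitvec.span S" if "x \<in> bitvec.span S" for x
    using that a by (metis add.commute bitvec.span_add bitvec_add_cancel)
  then have "bitvec.span S \<inter> (+) a ` bitvec.span S = {}" by auto
  moreover have "card ((+) a ` bitvec.span S) = card (bitvec.span S)"
    by (intro card_image) (auto simp: inj_on_def)
  ultimately show ?case
    unfolding span_insert_eq_Un using IH insert.hyps by (simp add: card_Un_disjoint)
qed

text \<open>This lets dimensions be computed, and hyperplanes be recognized, by counting.\<close>
lemma card_subspace: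
  assumes "bitvec.subspace W" "finite W"
  shows "card W = 2 ^ bitvec.dim W"
proof -
  obtain S where S: "S \<subseteq> W" "bitvec.independent S" "W \<subseteq> bitvec.span S" "card S = bitvec.dim W"
    using bitvec.basis_exists by blast
  have "bitvec.span S = W" using S assms bitvec.span_minimal by blast
  then show ?thesis using card_span_independent S assms finite_subset by metis
qed

lemma subspace_bit_space: "bitvec.subspace (bit_space k)"
  by (auto simp: subspace_iff_add_closed bit_space_def)

lemma zero_in_bit_space: "0 \<in> bit_space k"
  and add_in_bit_space: "u \<in> bit_space k \<Longrightarrow> w \<in> bit_space k \<Longrightarrow> u + w \<in> bit_space k"
  using subspace_bit_space subspace_iff_add_closed by auto

lemma finite_bit_space: "finite (bit_space k)" and card_bit_space: "card (bit_space k) = 2 ^ k"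
proof -
  have "bij_betw (\<lambda>u. {i. u i = 1}) (bit_space k) (Pow {..<k})"
  proof (rule bij_betw_byWitness[where f' = "\<lambda>S i. of_bool (i \<in> S)"])
    show "\<forall>u\<in>bit_space k. (\<lambda>i. of_bool (i \<in> {i. u i = 1})) = u"
    proof (intro ballI ext)
      fix u :: "nat \<Rightarrow> bit" and i
      show "of_bool (i \<in> {i. u i = 1}) = u i" by (cases "u i") simp_all
    qed
    show "(\<lambda>u. {i. u i = 1}) ` bit_space k \<subseteq> Pow {..<k}"
      unfolding bit_space_def by (auto simp: not_le[symmetric])
  qed (auto simp: bit_space_def)
  then show "finite (bit_space k)" "card (bit_space k) = 2 ^ k"
    by (auto simp: bij_betw_finite bij_betw_same_card card_Pow)
qed

definition unit_bitvec :: "nat \<Rightarrow> nat \<Rightarrow> bit" where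
  "unit_bitvec i = (\<lambda>j. of_bool (j = i))"

lemma unit_bitvec_in_bit_space: "i < k \<Longrightarrow> unit_bitvec i \<in> bit_space k"
  by (auto simp: unit_bitvec_def bit_space_def)

lemma bit_space_Suc_cases:
  assumes "u \<in> bit_space (Suc j)"
  obtains "u \<in> bit_space j" | w where "w \<in> bit_space j" "u = w + unit_bitvec j"
proof (cases "u j = 0")
  case True
  have "u i = 0" if "i \<ge> j" for i
    using that assms True by (cases "i = j") (simp_all add: bit_space_def)
  then have "u \<in> bit_space j" by (simp add: bit_space_def)
  then show ?thesis by (rule that)
next
  case False
  have "(u + unit_bitvec j) i = 0" if "i \<ge> j" for i
    using that assms False by (cases "i = j") (simp_all add: bit_space_def unit_bitvec_def)
  then have "u + unit_bitvec j \<in> bit_space j" by (simp add: bit_space_def)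
  moreover have "u = (u + unit_bitvec j) + unit_bitvec j"
    by (simp add: add.assoc bitvec_add_self)
  ultimately show ?thesis by (rule that)
qed

text \<open>
  These sets are the kernels of the linear functionals, the zero functional included, described
  without reference to the functional. Over the two-element field the condition says that membership
  is additive modulo two.
\<close>
definition functional_kernel :: "nat \<Rightarrow> (nat \<Rightarrow> bit) set \<Rightarrow> bool" where
  "functional_kernel k W \<longleftrightarrow> W \<subseteq> bit_space k \<and>
     (\<forall>u\<in>bit_space k. \<forall>w\<in>bit_space k. u + w \<in> W \<longleftrightarrow> (u \<in> W \<longleftrightarrow> w \<in> W))"

lemma functional_kernel_bit_space: "functional_kernel k (bit_space k)"
  by (auto simp: functional_kernel_def add_in_bit_space)

lemma functional_kernel_zero: "functional_kernel k W \<Longrightarrow> 0 \<in> W"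
  unfolding functional_kernel_def using zero_in_bit_space by (metis bitvec_add_self)

lemma functional_kernel_subspace: "functional_kernel k W \<Longrightarrow> bitvec.subspace W"
  using functional_kernel_zero[of k W] unfolding subspace_iff_add_closed functional_kernel_def by blast

text \<open>A functional is determined by its values on the unit vectors.\<close>
lemma functional_kernel_eqI:
  assumes W: "functional_kernel k W" and W': "functional_kernel k W'"
    and units: "\<And>i. i < k \<Longrightarrow> unit_bitvec i \<in> W \<longleftrightarrow> unit_bitvec i \<in> W'"
  shows "W = W'"
proof -
  have "j \<le> k \<Longrightarrow> \<forall>u\<in>bit_space j. u \<in> W \<longleftrightarrow> u \<in> W'" for j
  proof (induction j)
    case 0
    then show ?case using W W' functional_kernel_zero by (auto simp: bit_space_def fun_eq_iff zero_fun_def)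
  next
    case (Suc j)
    show ?case
    proof
      fix u assume "u \<in> bit_space (Suc j)"
      then show "u \<in> W \<longleftrightarrow> u \<in> W'"
      proof (cases rule: bit_space_Suc_cases)
        case 1
        then show ?thesis using Suc by simp
      next
        case (2 w)
        then have "w \<in> bit_space k" using Suc.prems by (auto simp: bit_space_def)
        then show ?thesis
          using 2 Suc units[of j] W W' unit_bitvec_in_bit_space[of j k]
          unfolding functional_kernel_def by auto
      qed
    qed
  qed
  from this[of k] have "\<forall>u\<in>bit_space k. u \<in> W \<longleftrightarrow> u \<in> W'" by blast
  then show ?thesis using W W' unfolding functional_kernel_def by blast
qed

lemma card_functional_kernels:
  "finite {W. functional_kernel k W}" "card {W. functional_kernel k W} \<le> 2 ^ k"
proof -
  let ?code = "\<lambda>W. {i. i < k \<and> unit_bitvec i \<in> W}"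
  have inj: "inj_on ?code {W. functional_kernel k W}"
    by (rule inj_onI, rule functional_kernel_eqI) (auto simp: set_eq_iff)
  have sub: "?code ` {W. functional_kernel k W} \<subseteq> Pow {..<k}" by auto
  show "finite {W. functional_kernel k W}"
    using inj_on_finite[OF inj sub] by simp
  show "card {W. functional_kernel k W} \<le> 2 ^ k"
    using card_inj_on_le[OF inj sub] by (simp add: card_Pow)
qed

text \<open>
  A hyperplane contains half of all vectors, so for \<open>u\<close> outside it, the translate by \<open>u\<close> is all of its
  complement. The sum of two vectors of the complement is therefore in the hyperplane.
\<close>
lemma hyperplane_functional_kernel:
  assumes "k > 0" and W: "bitvec.subspace W" "W \<subseteq> bit_space k" and dim: "bitvec.dim W = k - 1"
  shows "functional_kernel k W" and "W \<noteq> bit_space k"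
proof -
  have finW: "finite W" using W finite_bit_space finite_subset by blast
  have two: "2 * 2 ^ (k - 1) = (2::nat) ^ k" using \<open>k > 0\<close> by (cases k) auto
  have cW: "card W = 2 ^ (k - 1)" using card_subspace[OF W(1) finW] dim by simp
  then show "W \<noteq> bit_space k" using card_bit_space[of k] two by auto
  have closed: "u + w \<in> W" if "u \<in> W" "w \<in> W" for u w
    using that W(1) by (simp add: subspace_iff_add_closed)
  have shift: "u + w \<notin> W" if "u \<notin> W" "w \<in> W" for u w
    using that closed[of "u + w" w] by (metis add.assoc add.right_neutral bitvec_add_self)
  have both: "u + w \<in> W" if u: "u \<in> bit_space k" "u \<notin> W" and w: "w \<in> bit_space k" "w \<notin> W" for u w
  proof -
    have "(+) u ` W = bit_space k - W"
    proof (rule card_subset_eq)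
      show "finite (bit_space k - W)" using finite_bit_space by simp
      show "(+) u ` W \<subseteq> bit_space k - W" using u W shift add_in_bit_space by auto
      have "card ((+) u ` W) = card W" by (intro card_image) (auto simp: inj_on_def)
      then show "card ((+) u ` W) = card (bit_space k - W)"
        using cW W finW card_bit_space[of k] two by (simp add: card_Diff_subset)
    qed
    then obtain x where "x \<in> W" "w = u + x" using w by blast
    then show ?thesis by (simp add: bitvec_add_cancel)
  qed
  show "functional_kernel k W"
    unfolding functional_kernel_def using W closed shift both by (metis add.commute)
qed

text \<open>
  Hyperplanes are kernels of functionals other than zero, whose kernel is the whole space. By
  this bound, a family of \<open>2 ^ k - 1\<close> distinct hyperplane complements is complete.
\<close>
lemma card_PG_hyperplane_complements:
  assumes "k > 0"
  shows "finite (PG_hyperplane_complements k)" "card (PG_hyperplane_complements k) \<le> 2 ^ k - 1"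
proof -
  let ?K = "{W. functional_kernel k W} - {bit_space k}"
  have sub: "PG_hyperplane_complements k \<subseteq> (\<lambda>W. PG_points k - (W - {0})) ` ?K"
    unfolding PG_hyperplane_complements_def complement_blocks_def PG_hyperplanes_def
    using hyperplane_functional_kernel[OF assms] by auto
  have fin: "finite ?K" using card_functional_kernels by simp
  show "finite (PG_hyperplane_complements k)" using finite_subset[OF sub] fin by simp
  have "card (PG_hyperplane_complements k) \<le> card ?K"
    using card_mono[OF finite_imageI[OF fin] sub] card_image_le[OF fin] by (rule order_trans)
  also have "\<dots> = card {W. functional_kernel k W} - 1"
    using functional_kernel_bit_space card_functional_kernels(1) by (subst card_Diff_singleton) auto
  finally show "card (PG_hyperplane_complements k) \<le> 2 ^ k - 1"
    using card_functional_kernels(2)[of k] by linarith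
qed

section \<open>Finite elementary abelian 2-groups are binary vector spaces\<close>

text \<open>
  Take an embedding of a space of binary vectors with the greatest possible \<open>k\<close>; there is a bound
  because the group is finite. If some \<open>g\<close> were missing from the image, mapping a further unit vector
  to \<open>g\<close> would extend the embedding.
\<close>
lemma elementary_abelian_2_bit_space:
  fixes A (structure)
  assumes "comm_group A" and fin: "finite (carrier A)"
    and involutive: "\<And>x. x \<in> carrier A \<Longrightarrow> x \<otimes> x = \<one>"
  shows "\<exists>k \<phi>. bij_betw \<phi> (bit_space k) (carrier A) \<and>
           (\<forall>u\<in>bit_space k. \<forall>w\<in>bit_space k. \<phi> (u + w) = \<phi> u \<otimes> \<phi> w)"
proof -
  interpret comm_group A by fact
  define emb where "emb k \<phi> \<longleftrightarrow> inj_on \<phi> (bit_space k) \<and> \<phi> ` bit_space k \<subseteq> carrier A \<and>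
      (\<forall>u\<in>bit_space k. \<forall>w\<in>bit_space k. \<phi> (u + w) = \<phi> u \<otimes> \<phi> w)" for k and \<phi> :: "(nat \<Rightarrow> bit) \<Rightarrow> 'a"
  have "emb 0 (\<lambda>_. \<one>)" unfolding emb_def by (auto simp: inj_on_def bit_space_def fun_eq_iff)
  then have ex: "\<exists>\<phi>. emb 0 \<phi>" by blast
  have bound: "\<forall>k. (\<exists>\<phi>. emb k \<phi>) \<longrightarrow> k \<le> card (carrier A)"
  proof (intro allI impI)
    fix k assume "\<exists>\<phi>. emb k \<phi>"
    then have "card (bit_space k) \<le> card (carrier A)"
      unfolding emb_def using fin card_inj_on_le by blast
    then show "k \<le> card (carrier A)"
      unfolding card_bit_space using less_exp[of k] by linarith
  qed
  define k where "k = (GREATEST k. \<exists>\<phi>. emb k \<phi>)"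
  have "\<exists>\<phi>. emb k \<phi>" unfolding k_def using GreatestI_nat[of "\<lambda>k. \<exists>\<phi>. emb k \<phi>", OF ex] bound by blast
  then obtain \<phi> where \<phi>: "emb k \<phi>" by blast
  have max: "\<not> emb (Suc k) \<psi>" for \<psi>
    using Greatest_le_nat[of "\<lambda>k. \<exists>\<phi>. emb k \<phi>" "Suc k"] bound unfolding k_def[symmetric] by (metis Suc_n_not_le_n)
  have inj: "inj_on \<phi> (bit_space k)" and into: "\<And>u. u \<in> bit_space k \<Longrightarrow> \<phi> u \<in> carrier A"
    and hom: "\<And>u w. u \<in> bit_space k \<Longrightarrow> w \<in> bit_space k \<Longrightarrow> \<phi> (u + w) = \<phi> u \<otimes> \<phi> w"
    using \<phi> unfolding emb_def by auto
  have "carrier A \<subseteq> \<phi> ` bit_space k"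
  proof (rule ccontr)
    assume "\<not> ?thesis"
    then obtain g where g: "g \<in> carrier A" "g \<notin> \<phi> ` bit_space k" by blast
    \<comment> \<open>\<open>t u\<close> drops the coordinate \<open>k\<close> of \<open>u\<close>, and \<open>e\<close> maps that coordinate to a power of \<open>g\<close>.\<close>
    define t where "t u = u(k := 0)" for u :: "nat \<Rightarrow> bit"
    define e where "e c = (if c = 0 then \<one> else g)" for c :: bit
    define \<psi> where "\<psi> u = \<phi> (t u) \<otimes> e (u k)" for u
    have t: "t u \<in> bit_space k" if "u \<in> bit_space (Suc k)" for u
    proof -
      have "t u i = 0" if "i \<ge> k" for i
        using that \<open>u \<in> bit_space (Suc k)\<close> by (cases "i = k") (simp_all add: t_def bit_space_def)
      then show ?thesis by (simp add: bit_space_def)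
    qed
    have t_add: "t (u + w) = t u + t w" for u w by (auto simp: t_def fun_eq_iff)
    have e: "e c \<in> carrier A" for c using g by (simp add: e_def)
    have e_add: "e (c + d) = e c \<otimes> e d" for c d
      using involutive g by (cases c; cases d) (auto simp: e_def)
    have "emb (Suc k) \<psi>"
      unfolding emb_def
    proof (intro conjI ballI)
      show "\<psi> ` bit_space (Suc k) \<subseteq> carrier A" using into t e by (auto simp: \<psi>_def)
      show "\<psi> (u + w) = \<psi> u \<otimes> \<psi> w" if "u \<in> bit_space (Suc k)" "w \<in> bit_space (Suc k)" for u w
      proof -
        have "\<psi> (u + w) = (\<phi> (t u) \<otimes> \<phi> (t w)) \<otimes> (e (u k) \<otimes> e (w k))"
          unfolding \<psi>_def t_add hom[OF t[OF that(1)] t[OF that(2)]] e_add[symmetric] by (simp only: plus_fun_def)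
        then show ?thesis using that into t e by (simp add: \<psi>_def m_ac)
      qed
      show "inj_on \<psi> (bit_space (Suc k))"
      proof (rule inj_onI)
        fix u w assume u: "u \<in> bit_space (Suc k)" and w: "w \<in> bit_space (Suc k)" and eq: "\<psi> u = \<psi> w"
        note c = into[OF t[OF u]] into[OF t[OF w]] e[of "u k"] e[of "w k"]
        have "\<phi> (t u + t w) = e (u k) \<otimes> e (w k)"
        proof -
          \<comment> \<open>Insert the square of \<open>e (u k)\<close>, which is \<open>\<one>\<close>, to make \<open>\<psi> u\<close> appear.\<close>
          have "\<phi> (t u + t w) = \<phi> (t u) \<otimes> (e (u k) \<otimes> e (u k)) \<otimes> \<phi> (t w)"
            using c involutive hom[OF t[OF u] t[OF w]] by simp
          also have "\<dots> = \<psi> u \<otimes> e (u k) \<otimes> \<phi> (t w)"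
            using c by (simp add: \<psi>_def m_ac)
          also have "\<dots> = (\<phi> (t w) \<otimes> \<phi> (t w)) \<otimes> (e (u k) \<otimes> e (w k))"
            unfolding eq using c by (simp add: \<psi>_def m_ac)
          finally show ?thesis using c involutive by simp
        qed
        also have "\<dots> = e (u k + w k)" by (simp only: e_add)
        finally have *: "\<phi> (t u + t w) = e (u k + w k)" .
        have V: "t u + t w \<in> bit_space k" using t u w add_in_bit_space by blast
        have uw: "u k + w k = 0"
        proof (rule ccontr)
          assume "u k + w k \<noteq> 0"
          then have "\<phi> (t u + t w) = g" using * by (simp add: e_def)
          then show False using g V by blast
        qed
        have "\<phi> 0 = \<one>" using hom[OF zero_in_bit_space zero_in_bit_space] into[OF zero_in_bit_space]
          by (metis add.right_neutral involutive)
        then have "\<phi> (t u + t w) = \<phi> 0" using * uw by (simp add: e_def)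
        then have "t u + t w = 0" using inj V zero_in_bit_space by (auto dest: inj_onD)
        then have tt: "t u = t w" by (simp add: bitvec_add_eq_0_iff)
        have "u k = w k" using uw by (cases "u k"; cases "w k") auto
        show "u = w"
        proof
          fix i show "u i = w i"
            using fun_cong[OF tt, of i] \<open>u k = w k\<close> by (cases "i = k") (auto simp: t_def)
        qed
      qed
    qed
    then show False using max by blast
  qed
  then have "bij_betw \<phi> (bit_space k) (carrier A)"
    using inj into by (auto simp: bij_betw_def)
  then show ?thesis using hom by blast
qed

section \<open>The moved part as a projective space\<close>

context pyramidal_hadamard
begin

text \<open>
  The map \<open>\<psi>\<close> takes a vector to the image of \<open>z\<close> under the corresponding group element, so \<open>0\<close> goes
  to \<open>z\<close>. Under it, \<open>B \<inter> M\<close> corresponds to the subspace of the vectors whose group elements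
  stabilize \<open>B\<close>. It has \<open>m = 2 ^ (k - 1)\<close> elements and is thus a hyperplane. That every hyperplane
  arises follows by comparing cardinalities.
\<close>
lemma moved_design_isomorphic:
  assumes z: "z \<in> M" and \<phi>: "bij_betw \<phi> (bit_space k) G"
    and hom: "\<And>u w. u \<in> bit_space k \<Longrightarrow> w \<in> bit_space k \<Longrightarrow> \<phi> (u + w) = compose P (\<phi> u) (\<phi> w)"
    and k: "2 * m = 2 ^ k" "k > 0"
  shows "design_isomorphic (M - {z}) ((\<lambda>B. M - B) ` star z) (PG_points k) (PG_hyperplane_complements k)"
proof -
  define \<psi> where "\<psi> u = \<phi> u z" for u
  have \<phi>G: "\<phi> u \<in> G" if "u \<in> bit_space k" for u using \<phi> that bij_betwE by blast
  have zP: "z \<in> P" using z by (simp add: M_def)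
  have m: "m = 2 ^ (k - 1)" using k by (cases k) auto
  have \<psi>: "bij_betw \<psi> (bit_space k) M"
    using bij_betw_trans[OF \<phi> orbit_bij[OF z]] by (simp add: \<psi>_def[abs_def] comp_def)
  have "\<phi> 0 = (\<lambda>x\<in>P. x)"
    using hom[OF zero_in_bit_space zero_in_bit_space] compose_self[OF \<phi>G[OF zero_in_bit_space]] by simp
  then have \<psi>0: "\<psi> 0 = z" using zP by (simp add: \<psi>_def)
  have points: "bij_betw \<psi> (PG_points k) (M - {z})"
    unfolding PG_points_def using bij_betw_DiffI[OF \<psi>, of "{0}" "{z}"] \<psi>0 zero_in_bit_space z
    by (simp add: bij_betw_def)
  define f where "f = inv_into (PG_points k) \<psi>"
  have f: "bij_betw f (M - {z}) (PG_points k)" unfolding f_def using points by (rule bij_betw_inv_into)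
  have f_\<psi>: "f (\<psi> u) = u" if "u \<in> PG_points k" for u
    unfolding f_def using points that by (simp add: bij_betw_inv_into_left)
  define K where "K B = {u \<in> bit_space k. \<psi> u \<in> B}" for B
  have kernel: "functional_kernel k (K B)" if B: "B \<in> star z" for B
  proof -
    have B': "B \<in> \<B>" "B \<noteq> F" "z \<in> B" using star_block[OF z B] B by (auto simp: star_def)
    have "\<psi> (u + w) \<in> B \<longleftrightarrow> (\<psi> u \<in> B \<longleftrightarrow> \<psi> w \<in> B)" if u: "u \<in> bit_space k" and w: "w \<in> bit_space k" for u w
    proof -
      have "\<psi> (u + w) = \<phi> u (\<psi> w)" using hom[OF u w] zP by (simp add: \<psi>_def compose_def)
      moreover have "\<psi> w \<in> M" using \<psi> w bij_betwE by blast
      ultimately have "\<psi> (u + w) \<in> B \<longleftrightarrow> (\<psi> w \<in> B \<longleftrightarrow> \<phi> u ` B = B)"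
        using mem_block_iff[OF B'(1,2) \<phi>G[OF u]] by simp
      moreover have "\<psi> u \<in> B \<longleftrightarrow> \<phi> u ` B = B"
        unfolding \<psi>_def using mem_block_iff[OF B'(1,2) \<phi>G[OF u] z] B'(3) by simp
      ultimately show ?thesis by blast
    qed
    then show ?thesis unfolding functional_kernel_def K_def using add_in_bit_space by blast
  qed
  have dim: "bitvec.dim (K B) = k - 1" if B: "B \<in> star z" for B
  proof -
    have "\<psi> ` K B = B \<inter> \<psi> ` bit_space k" by (auto simp: K_def)
    then have "\<psi> ` K B = B \<inter> M" using bij_betw_imp_surj_on[OF \<psi>] by simp
    moreover have "inj_on \<psi> (K B)"
      using \<psi> unfolding K_def bij_betw_def by (auto intro: inj_on_subset)
    ultimately have "card (K B) = card (B \<inter> M)" by (metis card_image)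
    also have "\<dots> = m" using card_block_Int(2) star_block[OF z B] by blast
    finally have "card (K B) = 2 ^ (k - 1)" using m by simp
    moreover have "card (K B) = 2 ^ bitvec.dim (K B)"
      using finite_bit_space by (intro card_subspace functional_kernel_subspace[OF kernel[OF B]]) (simp add: K_def)
    ultimately show ?thesis by simp
  qed
  have image: "f ` (M - B) = PG_points k - (K B - {0})" if B: "B \<in> star z" for B
  proof -
    have "z \<in> B" using B by (simp add: star_def)
    then have "M - B = (M - {z}) - B" by blast
    also have "\<dots> = \<psi> ` PG_points k - B" using bij_betw_imp_surj_on[OF points] by simp
    also have "\<dots> = \<psi> ` (PG_points k - (K B - {0}))" by (auto simp: PG_points_def K_def)
    finally have "M - B = \<psi> ` (PG_points k - (K B - {0}))" .
    then show ?thesis using f_\<psi> by (simp add: image_image)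
  qed
  have "(\<lambda>X. f ` X) ` (\<lambda>B. M - B) ` star z = PG_hyperplane_complements k"
  proof (rule card_seteq)
    show "finite (PG_hyperplane_complements k)" using card_PG_hyperplane_complements(1) k by blast
    show "(\<lambda>X. f ` X) ` (\<lambda>B. M - B) ` star z \<subseteq> PG_hyperplane_complements k"
    proof (clarify)
      fix B assume B: "B \<in> star z"
      have "K B - {0} \<in> PG_hyperplanes k"
        unfolding PG_hyperplanes_def using functional_kernel_subspace[OF kernel[OF B]] dim[OF B]
        by (auto simp: K_def)
      then show "f ` (M - B) \<in> PG_hyperplane_complements k"
        unfolding image[OF B] PG_hyperplane_complements_def complement_blocks_def by blast
    qed
    have "inj_on (\<lambda>X. f ` X) ((\<lambda>B. M - B) ` star z)"
    proof (rule inj_on_subset[OF inj_on_image_Pow[OF bij_betw_imp_inj_on[OF f]]])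
      show "(\<lambda>B. M - B) ` star z \<subseteq> Pow (M - {z})" by (auto simp: star_def)
    qed
    then have "card ((\<lambda>X. f ` X) ` (\<lambda>B. M - B) ` star z) = 2 ^ k - 1"
      using inj_moved_trace[OF z] card_star[OF z] k by (simp add: card_image)
    then show "card (PG_hyperplane_complements k) \<le> card ((\<lambda>X. f ` X) ` (\<lambda>B. M - B) ` star z)"
      using card_PG_hyperplane_complements(2) k by simp
  qed
  then show ?thesis unfolding design_isomorphic_def using f by blast
qed

end

theorem theorem3p5:
  fixes m :: nat and P :: "'a set" and \<B> :: "'a set set" and G :: "('a \<Rightarrow> 'a) set"
  assumes "m > 1"
    and "hadamard_design P \<B> m"
    and "pyramidal_under (2 * m - 1) P \<B> G"
  shows "\<exists>k::nat. k > 1 \<and>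
    (elementary_abelian 2 ((AutDesign P \<B>)\<lparr>carrier := G\<rparr>) \<and>
      order ((AutDesign P \<B>)\<lparr>carrier := G\<rparr>) = 2 * m \<and> 2 * m = 2 ^ k) \<and>
    (\<exists>P\<^sub>1 \<B>\<^sub>1 Z \<B>\<^sub>2.
      symmetric_design P\<^sub>1 \<B>\<^sub>1 (2 ^ k - 1) (2 ^ (k - 1)) (2 ^ (k - 2)) \<and>
      design_isomorphic Z \<B>\<^sub>2 (PG_points k) (PG_hyperplane_complements k) \<and>
      sum_of_designs (k + 1) P (complement_blocks P \<B>) P\<^sub>1 \<B>\<^sub>1 Z \<B>\<^sub>2)"
proof -
  interpret pyramidal_hadamard m P \<B> G using assms by unfold_locales
  obtain z where z: "z \<in> M" using M_nonempty by blast
  have "finite (carrier \<G>)" using finite_G by simp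
  from elementary_abelian_2_bit_space[OF comm_group_G this mult_self]
  obtain k \<phi> where \<phi>: "bij_betw \<phi> (bit_space k) (carrier \<G>)"
    and hom: "\<And>u w. u \<in> bit_space k \<Longrightarrow> w \<in> bit_space k \<Longrightarrow> \<phi> (u + w) = \<phi> u \<otimes>\<^bsub>\<G>\<^esub> \<phi> w"
    by blast
  have \<phi>': "bij_betw \<phi> (bit_space k) G" using \<phi> by simp
  have hom': "\<phi> (u + w) = compose P (\<phi> u) (\<phi> w)" if "u \<in> bit_space k" "w \<in> bit_space k" for u w
    using hom[OF that] mult_eq bij_betwE[OF \<phi>'] that by simp
  have k: "2 * m = 2 ^ k" using bij_betw_same_card[OF \<phi>'] card_G card_bit_space by simp
  have k1: "k > 1"
  proof (rule ccontr)
    assume "\<not> k > 1"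
    then have "k = 0 \<or> k = 1" by auto
    then show False using k m_gt_1 by auto
  qed
  have "sum_of_designs (k + 1) P (complement_blocks P \<B>)
      F ((\<lambda>B. F - B) ` star z) (M - {z}) ((\<lambda>B. M - B) ` star z)"
    using complement_sum[OF z k k1] .
  moreover have "symmetric_design F ((\<lambda>B. F - B) ` star z) (2 ^ k - 1) (2 ^ (k - 1)) (2 ^ (k - 2))"
    using fixed_design[OF z] by (simp only: power_of_two_parameters[OF k k1, symmetric])
  moreover have "design_isomorphic (M - {z}) ((\<lambda>B. M - B) ` star z) (PG_points k) (PG_hyperplane_complements k)"
  proof (rule moved_design_isomorphic[OF z \<phi>' _ k])
    show "k > 0" using k1 by simp
  qed (rule hom')
  moreover have "order \<G> = 2 * m" using card_G by (simp add: order_def)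
  ultimately show ?thesis
    using elementary_abelian_G k k1
    by (intro exI[of _ k] conjI exI[of _ F] exI[of _ "(\<lambda>B. F - B) ` star z"]
          exI[of _ "M - {z}"] exI[of _ "(\<lambda>B. M - B) ` star z"])
qed

end
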